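(* For every nonempty short impartial game $G$, $$s(G)=\begin{cases}\infty & \text{if } 0\in G,\\ \operatorname{mex}\big(\{s(G')\mid G'\in G\}\big) & \text{otherwise.}\end{cases}$$
   Context: All games are short impartial games under normal play (a player unable to move loses): a position is identified with its finite set of options, which are themselves short impartial games; there are no infinite plays. The empty game (no options) is denoted $0$. $G'\in G$ means that $G'$ is an option of $G$; in particular $0\in G$ means that the empty game is an option of $G$. $G\equiv H$ means that $G$ and $H$ have the same option sets (are identical as games). A $\mathcal P$-position is a game in which the previous player (the player not about to move) has a winning strategy; other games are $\mathcal N$-positions. $G=0$ means that $G$ is a $\mathcal P$-position. The nimber $*n$ is the game with options $*k$, $0\le k<n$. The split sum $G\circ H$ is defined recursively by: $G\circ H\equiv 0$ if $G\equiv 0$; $G\circ H\equiv G$ if $H\equiv 0$; and otherwise $G\circ H\equiv\{G\circ h,\ g\circ H\}$, where $g$ ranges over the options of $G$ and $h$ over the options of $H$. For a nonempty game $G$, the split value $s(G)$ is the non-negative integer $n$ such that $G\circ( *n)=0$ if such $n$ exists (it is then unique), and $s(G)=\infty$ if $G\circ( *n)\neq 0$ for all $n$. $\operatorname{mex}(A)$ is the least non-negative integer not in $A$ (the set $A$ may contain the symbol $\infty$, which is irrelevant to the mex). *)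

theory Defs
  imports "HOL-Library.FSet" "HOL-Library.Extended_Nat"
begin

datatype game = Game (options: "game fset")

lemma size_option [simp]: "G' |\<in>| options G \<Longrightarrow> size G' < size G"
  by (cases G) (auto simp: size_fset_overloaded_simps less_Suc_eq_le
      intro: member_le_sum[of _ _ "\<lambda>x. Suc (size x)", THEN Suc_leD])

definition empty_game :: game where
  "empty_game = Game {||}"

text \<open>
  A strategy maps each position from which its owner has to move to the position moved to; since
  a position determines all that can follow, strategies that ignore the history suffice.
  \<^term>\<open>reachable \<sigma> G H\<close> means that play from \<^term>\<open>G\<close>, the opponent moving first and the owner
  following \<^term>\<open>\<sigma>\<close>, can arrive at \<^term>\<open>H\<close> with the opponent to move.
\<close>

inductive reachable :: "(game \<Rightarrow> game) \<Rightarrow> game \<Rightarrow> game \<Rightarrow> bool" for \<sigma> G where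
  start: "reachable \<sigma> G G"
| step: "reachable \<sigma> G H \<Longrightarrow> H' |\<in>| options H \<Longrightarrow> reachable \<sigma> G (\<sigma> H')"

text \<open>
  The strategy wins for the previous player if it answers every opposing move by a legal move:
  there are no infinite plays, so it is then the opponent who gets stuck.
\<close>

definition winning_for_previous :: "(game \<Rightarrow> game) \<Rightarrow> game \<Rightarrow> bool" where
  "winning_for_previous \<sigma> G \<longleftrightarrow>
     (\<forall>H. reachable \<sigma> G H \<longrightarrow> (\<forall>H'. H' |\<in>| options H \<longrightarrow> \<sigma> H' |\<in>| options H'))"

definition P_position :: "game \<Rightarrow> bool" where
  "P_position G \<longleftrightarrow> (\<exists>\<sigma>. winning_for_previous \<sigma> G)"

lemma reachable_trans:
  "reachable \<sigma> H K \<Longrightarrow> reachable \<sigma> G H \<Longrightarrow> reachable \<sigma> G K"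
  by (induction rule: reachable.induct) (auto intro: reachable.intros)

lemma P_position_two_step:
  "P_position G \<longleftrightarrow>
     (\<forall>G'. G' |\<in>| options G \<longrightarrow> (\<exists>G''. G'' |\<in>| options G' \<and> P_position G''))"
proof -
  have fwd: "\<exists>G''. G'' |\<in>| options G' \<and> P_position G''"
    if "P_position G" "G' |\<in>| options G" for G G'
  proof -
    from that(1) obtain \<sigma> where \<sigma>: "winning_for_previous \<sigma> G"
      by (auto simp: P_position_def)
    have r: "reachable \<sigma> G (\<sigma> G')"
      using that(2) by (auto intro: reachable.intros)
    have "winning_for_previous \<sigma> (\<sigma> G')"
      using \<sigma> reachable_trans[OF _ r] unfolding winning_for_previous_def by blast
    moreover have "\<sigma> G' |\<in>| options G'"
      using \<sigma> that(2) unfolding winning_for_previous_def by (auto intro: reachable.intros)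
    ultimately show ?thesis
      unfolding P_position_def by blast
  qed
  have "P_position G"
    if G: "\<forall>G'. G' |\<in>| options G \<longrightarrow> (\<exists>G''. G'' |\<in>| options G' \<and> P_position G'')"
  proof -
    define \<sigma> where "\<sigma> = (\<lambda>H. SOME K. K |\<in>| options H \<and> P_position K)"
    have \<sigma>: "\<sigma> H |\<in>| options H \<and> P_position (\<sigma> H)"
      if "\<exists>K. K |\<in>| options H \<and> P_position K" for H
      unfolding \<sigma>_def using that by (rule someI_ex)
    have "\<forall>H'. H' |\<in>| options H \<longrightarrow> (\<exists>K. K |\<in>| options H' \<and> P_position K)"
      if "reachable \<sigma> G H" for H
      using that
    proof (induction rule: reachable.induct)
      case start
      show ?case by (fact G)
    next
      case (step H H')
      then have "P_position (\<sigma> H')" using \<sigma> by blast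
      then show ?case using fwd by blast
    qed
    then have "winning_for_previous \<sigma> G"
      unfolding winning_for_previous_def using \<sigma> by blast
    then show ?thesis unfolding P_position_def by blast
  qed
  with fwd show ?thesis by blast
qed

lemma P_position_iff:
  "P_position G \<longleftrightarrow> (\<forall>G'. G' |\<in>| options G \<longrightarrow> \<not> P_position G')"
proof (induction "size G" arbitrary: G rule: less_induct)
  case less
  then have "\<not> P_position G' \<longleftrightarrow> (\<exists>G''. G'' |\<in>| options G' \<and> P_position G'')"
    if "G' |\<in>| options G" for G'
    using that size_option by blast
  then show ?case
    using P_position_two_step by blast
qed

function split_sum :: "game \<Rightarrow> game \<Rightarrow> game" where
  "split_sum G H =
     (if G = empty_game then empty_game
      else if H = empty_game then G
      else Game ((\<lambda>h. split_sum G h) |`| options H |\<union>| (\<lambda>g. split_sum g H) |`| options G))"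
  by auto
termination
  by (relation "measure (\<lambda>(G, H). size G + size H)") auto

declare split_sum.simps [simp del]

function nimber :: "nat \<Rightarrow> game" where
  "nimber n = Game (nimber |`| fset_of_list [0..<n])"
  by auto
termination
  by (relation "measure id") (auto simp: fset_of_list_elem)

declare nimber.simps [simp del]

lemma options_nimber: "K |\<in>| options (nimber n) \<longleftrightarrow> (\<exists>k<n. K = nimber k)"
  by (subst nimber.simps) (auto simp: fset_of_list_elem)

lemma split_sum_nimber_unique:
  assumes "G \<noteq> empty_game"
    and "P_position (split_sum G (nimber m))" "P_position (split_sum G (nimber n))"
  shows "m = n"
proof -
  have "\<not> P_position (split_sum G (nimber n))"
    if "m < n" "P_position (split_sum G (nimber m))" for m n
  proof -
    have "nimber m |\<in>| options (nimber n)"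
      using that(1) options_nimber by blast
    moreover from this have "nimber n \<noteq> empty_game"
      by (auto simp: empty_game_def)
    ultimately have "split_sum G (nimber m) |\<in>| options (split_sum G (nimber n))"
      using assms(1) by (subst (2) split_sum.simps) auto
    with that(2) show ?thesis
      using P_position_iff by blast
  qed
  with assms(2,3) show ?thesis
    by (meson linorder_neqE_nat)
qed

text \<open>
  On \<^const>\<open>empty_game\<close> the value is unspecified, since \<^term>\<open>split_sum empty_game (nimber n)\<close> is a
  P-position for every \<^term>\<open>n\<close>.
\<close>

definition split_value :: "game \<Rightarrow> enat" where
  "split_value G =
     (if \<exists>n. P_position (split_sum G (nimber n))
      then enat (THE n. P_position (split_sum G (nimber n)))
      else \<infinity>)"

definition mex :: "enat set \<Rightarrow> nat" where
  "mex A = (LEAST n. enat n \<notin> A)"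

end

theory Submission
  imports Defs
begin

text \<open>
  For a fixed nonempty \<open>G\<close> ask for which \<open>n\<close> the game \<open>G \<circ> *n\<close> is a P-position. The two components
  behave differently when they become empty. By moving from \<open>G\<close> to the empty game a player leaves
  nothing at all and wins at once, so every \<open>G \<circ> *n\<close> is an N-position if \<open>G\<close> has this option. Moving
  from \<open>*n\<close> to \<open>*0\<close> leaves \<open>G\<close> in play, as the game \<open>G \<circ> *0\<close>.

  If \<open>G\<close> does not have the empty option, then \<open>G \<circ> *n\<close> is a P-position iff no \<open>G \<circ> *k\<close> with
  \<open>k < n\<close> is one and no option of \<open>G\<close> has split value \<open>n\<close>
  (\<open>P_position_split_sum_nimber_iff\<close>). Such a recursion in \<open>n\<close> is satisfied by the least number
  that is not the split value of an option, and by no other (\<open>greedy_iff_Least\<close>); this number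
  exists because there are only finitely many options.
\<close>

lemma nimber_eq_empty_game_iff: "nimber n = empty_game \<longleftrightarrow> n = 0"
proof
  assume "nimber n = empty_game"
  then have "\<not> (\<exists>K. K |\<in>| options (nimber n))"
    by (simp add: empty_game_def)
  then show "n = 0"
    by (auto simp: options_nimber)
next
  assume "n = 0"
  then show "nimber n = empty_game"
    by (subst nimber.simps) (simp add: empty_game_def)
qed

lemma P_position_empty_game: "P_position empty_game"
  by (subst P_position_iff) (simp add: empty_game_def)

lemma split_sum_empty_left: "split_sum empty_game H = empty_game"
  by (subst split_sum.simps) simp

lemma split_sum_empty_right: "split_sum G empty_game = G"
  by (subst split_sum.simps) simp

text \<open>
  The recursive clause of the split sum covers \<open>n > 0\<close> only. The same description fits the other
  clause, \<open>n = 0\<close>: there is no \<open>k < 0\<close>, and the options of \<open>G \<circ> *0 = G\<close> are the \<open>g = g \<circ> *0\<close>.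
  Hence later arguments need not treat \<open>n = 0\<close> separately.
\<close>

lemma options_split_sum_nimber:
  assumes "G \<noteq> empty_game"
  shows "K |\<in>| options (split_sum G (nimber n)) \<longleftrightarrow>
    (\<exists>k<n. K = split_sum G (nimber k)) \<or> (\<exists>g. g |\<in>| options G \<and> K = split_sum g (nimber n))"
proof (cases "n = 0")
  case True
  then have "nimber n = empty_game"
    by (simp add: nimber_eq_empty_game_iff)
  with True show ?thesis
    by (auto simp: split_sum_empty_right)
next
  case False
  then have "split_sum G (nimber n) =
      Game ((\<lambda>h. split_sum G h) |`| options (nimber n) |\<union>| (\<lambda>g. split_sum g (nimber n)) |`| options G)"
    using assms by (subst split_sum.simps) (simp add: nimber_eq_empty_game_iff)
  then show ?thesis
    by (auto simp: options_nimber image_iff) (metis options_nimber)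
qed

lemma split_value_eq_enat_iff:
  assumes "G \<noteq> empty_game"
  shows "split_value G = enat n \<longleftrightarrow> P_position (split_sum G (nimber n))"
proof -
  have "(THE m. P_position (split_sum G (nimber m))) = k"
    if "P_position (split_sum G (nimber k))" for k
    using that split_sum_nimber_unique[OF assms] by blast
  then show ?thesis
    unfolding split_value_def by auto
qed

text \<open>
  The winning move is to the empty option of \<open>G\<close>, which annihilates the nimber.
\<close>

lemma split_value_eq_infinity:
  assumes "empty_game |\<in>| options G"
  shows "split_value G = \<infinity>"
proof -
  have G: "G \<noteq> empty_game"
    using assms by (auto simp: empty_game_def)
  have "empty_game |\<in>| options (split_sum G (nimber n))" for n
    using assms split_sum_empty_left options_split_sum_nimber[OF G] by metis
  then have "\<not> P_position (split_sum G (nimber n))" for n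
    using P_position_empty_game P_position_iff by blast
  then show ?thesis
    by (simp add: split_value_def)
qed

lemma P_position_split_sum_nimber_iff:
  assumes "G \<noteq> empty_game" and "empty_game |\<notin>| options G"
  shows "P_position (split_sum G (nimber n)) \<longleftrightarrow>
    enat n \<notin> {split_value G' | G'. G' |\<in>| options G} \<and>
    (\<forall>k<n. \<not> P_position (split_sum G (nimber k)))"
proof -
  have "split_value g = enat n \<longleftrightarrow> P_position (split_sum g (nimber n))"
    if "g |\<in>| options G" for g
    using that assms(2) by (intro split_value_eq_enat_iff) auto
  then have "enat n \<notin> {split_value G' | G'. G' |\<in>| options G} \<longleftrightarrow>
      (\<forall>g. g |\<in>| options G \<longrightarrow> \<not> P_position (split_sum g (nimber n)))"
    by (auto; metis)
  then show ?thesis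
    by (subst P_position_iff) (auto simp: options_split_sum_nimber[OF assms(1)])
qed

text \<open>
  Below the least \<open>n\<close> with \<open>Q n\<close> the recursion makes \<open>R\<close> fail because \<open>Q\<close> fails, and above it
  because \<open>R\<close> already holds at a smaller number.
\<close>

lemma greedy_iff_Least:
  fixes Q R :: "nat \<Rightarrow> bool"
  assumes rec: "\<And>n. R n \<longleftrightarrow> Q n \<and> (\<forall>k<n. \<not> R k)" and "\<exists>n. Q n"
  shows "R n \<longleftrightarrow> n = (LEAST n. Q n)"
proof -
  let ?m = "LEAST n. Q n"
  have "Q ?m"
    using assms(2) by (rule LeastI_ex)
  moreover have "\<not> R k" if "k < ?m" for k
    using that rec not_less_Least by blast
  ultimately have "R ?m"
    using rec by blast
  then show ?thesis
    using rec by (metis linorder_neqE_nat)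
qed

lemma enat_not_in_finite:
  assumes "finite A"
  shows "\<exists>n. enat n \<notin> A"
proof -
  have "finite (enat -` A)"
    using assms by (intro finite_vimageI) (auto simp: inj_def)
  then have "enat -` A \<noteq> UNIV"
    by (metis infinite_UNIV_nat)
  then show ?thesis
    by auto
qed

theorem theorem4:
  fixes G :: game
  assumes "G \<noteq> empty_game"
  shows "split_value G =
    (if empty_game |\<in>| options G then \<infinity>
     else enat (mex {split_value G' | G'. G' |\<in>| options G}))"
proof (cases "empty_game |\<in>| options G")
  case True
  then show ?thesis
    by (simp add: split_value_eq_infinity)
next
  case False
  let ?A = "{split_value G' | G'. G' |\<in>| options G}"
  have "?A = split_value ` fset (options G)"
    by auto
  then have "\<exists>n. enat n \<notin> ?A"
    using enat_not_in_finite by simp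
  with P_position_split_sum_nimber_iff[OF assms False]
  have "P_position (split_sum G (nimber n)) \<longleftrightarrow> n = (LEAST n. enat n \<notin> ?A)" for n
    by (rule greedy_iff_Least)
  then have "P_position (split_sum G (nimber (mex ?A)))"
    unfolding mex_def by blast
  then show ?thesis
    using False split_value_eq_enat_iff[OF assms] by simp
qed

end
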